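(* One has $$d^\star(f;X)\ \ge\ n-m_-(f;X)\ \ge\ \sup_{z\in\widehat X}n_+(\nabla^2f(z)).$$
   Context: $X\subset\mathbb{R}^n$ is compact and full dimensional (its affine hull is $\mathbb{R}^n$), $\widehat X=\operatorname{conv}X$, and $f$ is a real-valued $C^2$ function on an open neighborhood of $\widehat X$. $\mathcal{D}^2(f;X)$ is the set of pairs $(g,h)$ of functions that are $C^2$ on a neighborhood of $\widehat X$, satisfy $f=g-h$ there, and are convex on $\widehat X$ (equivalently, have positive semidefinite Hessians at every point of $\widehat X$). For a $C^2$ convex $g$: $V_X(g)=\operatorname{span}\bigl(\bigcup_{z\in\widehat X}\operatorname{range}\nabla^2g(z)\bigr)$, $d_X(g)=\dim V_X(g)$, and $d^\star(f;X)=\min_{(g,h)\in\mathcal{D}^2(f;X)}d_X(g)$. $m_-(f;X)=\max\{\dim W: W\subset\mathbb{R}^n\text{ a subspace with }w^\top\nabla^2f(z)w\le0\text{ for all }w\in W,\ z\in\widehat X\}$. For a symmetric matrix $Q$, $n_+(Q)$ is the number of positive eigenvalues of $Q$, counted with multiplicity. *)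

theory Defs
  imports "HOL-Analysis.Analysis"
begin

definition gradient :: "(real^'n \<Rightarrow> real) \<Rightarrow> real^'n \<Rightarrow> real^'n" where
  "gradient f x = (\<chi> i. frechet_derivative f (at x) (axis i 1))"

definition hessian :: "(real^'n \<Rightarrow> real) \<Rightarrow> real^'n \<Rightarrow> real^'n^'n" where
  "hessian f x = matrix (frechet_derivative (gradient f) (at x))"

(* Intended for open U only; then "differentiable within U" is differentiability at every
   point of U, and the derivatives in gradient and hessian are the actual ones. *)
definition C2_on :: "(real^'n) set \<Rightarrow> (real^'n \<Rightarrow> real) \<Rightarrow> bool" where
  "C2_on U f \<longleftrightarrow>
     f differentiable_on U \<and> gradient f differentiable_on U \<and> continuous_on U (hessian f)"

(* Functions given on a neighbourhood of the hull are represented by total functions; their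
   values outside that neighbourhood play no role. *)
definition D2 :: "(real^'n \<Rightarrow> real) \<Rightarrow> (real^'n) set \<Rightarrow> ((real^'n \<Rightarrow> real) \<times> (real^'n \<Rightarrow> real)) set" where
  "D2 f X = {(g, h).
     (\<exists>U. open U \<and> convex hull X \<subseteq> U \<and> C2_on U g \<and> C2_on U h \<and> (\<forall>x\<in>U. f x = g x - h x)) \<and>
     convex_on (convex hull X) g \<and> convex_on (convex hull X) h}"

definition V_space :: "(real^'n) set \<Rightarrow> (real^'n \<Rightarrow> real) \<Rightarrow> (real^'n) set" where
  "V_space X g = span (\<Union>z\<in>convex hull X. range (\<lambda>v. hessian g z *v v))"

definition d_dim :: "(real^'n) set \<Rightarrow> (real^'n \<Rightarrow> real) \<Rightarrow> nat" where
  "d_dim X g = dim (V_space X g)"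

(* An infimum of natural numbers, hence a minimum as soon as D2 f X is nonempty, which holds for
   compact X and f of class C2 near the hull. (On an empty set this infimum would be 0.) *)
definition d_star :: "(real^'n \<Rightarrow> real) \<Rightarrow> (real^'n) set \<Rightarrow> nat" where
  "d_star f X = (INF (g, h) \<in> D2 f X. d_dim X g)"

definition m_minus :: "(real^'n \<Rightarrow> real) \<Rightarrow> (real^'n) set \<Rightarrow> nat" where
  "m_minus f X = Max {dim W | W. subspace W \<and>
     (\<forall>w\<in>W. \<forall>z\<in>convex hull X. w \<bullet> (hessian f z *v w) \<le> 0)}"

definition eigenspace :: "real^'n^'n \<Rightarrow> real \<Rightarrow> (real^'n) set" where
  "eigenspace Q l = {v. Q *v v = l *\<^sub>R v}"

(* Meant for symmetric Q, where the multiplicity of an eigenvalue is the dimension of its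
   eigenspace. The index set is finite, as eigenvectors to distinct eigenvalues are independent. *)
definition n_plus :: "real^'n^'n \<Rightarrow> nat" where
  "n_plus Q = (\<Sum>l | 0 < l \<and> eigenspace Q l \<noteq> {0}. dim (eigenspace Q l))"

end

theory Submission imports Defs
begin

text \<open>If \<open>f = g - h\<close> with \<open>g\<close>, \<open>h\<close> convex, then the Hessian of \<open>f\<close> is negative semidefinite on the
  orthogonal complement of \<open>V_space X g\<close> at every point of the hull; this is the first inequality.
  For the second, the Hessian of \<open>f\<close> at a point is positive definite on the sum of the eigenspaces
  to positive eigenvalues, so this sum meets trivially every subspace on which the form is
  nonpositive. The symmetry of the Hessian and its semidefiniteness for convex functions both come
  from the limit of the mixed second difference quotient in two directions \<open>a\<close>, \<open>b\<close>: it is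
  symmetric in \<open>a\<close>, \<open>b\<close>, and for \<open>b = - a\<close> it is nonpositive by midpoint convexity.\<close>

section \<open>Gradient and Hessian as Frechet derivatives\<close>

lemma C2_on_has_derivative:
  fixes f :: "real^'n \<Rightarrow> real"
  assumes "C2_on U f" "open U" "x \<in> U"
  shows "(f has_derivative (\<lambda>v. gradient f x \<bullet> v)) (at x)"
proof -
  have "f differentiable (at x)"
    using assms by (simp add: C2_on_def differentiable_on_eq_differentiable_at)
  then have D: "(f has_derivative frechet_derivative f (at x)) (at x)"
    by (simp add: frechet_derivative_works)
  then interpret linear "frechet_derivative f (at x)"
    by (rule has_derivative_linear)
  have "frechet_derivative f (at x) = (\<lambda>v. gradient f x \<bullet> v)"
  proof
    fix v
    have "frechet_derivative f (at x) v = frechet_derivative f (at x) (\<Sum>i\<in>UNIV. v $ i *s axis i 1)"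
      by (simp add: basis_expansion)
    then show "frechet_derivative f (at x) v = gradient f x \<bullet> v"
      by (simp add: sum scalar_mult_eq_scaleR scale inner_vec_def gradient_def mult.commute)
  qed
  with D show ?thesis
    by simp
qed

lemma C2_on_gradient_has_derivative:
  fixes f :: "real^'n \<Rightarrow> real"
  assumes "C2_on U f" "open U" "x \<in> U"
  shows "(gradient f has_derivative (*v) (hessian f x)) (at x)"
proof -
  have "gradient f differentiable (at x)"
    using assms by (simp add: C2_on_def differentiable_on_eq_differentiable_at)
  then have D: "(gradient f has_derivative frechet_derivative (gradient f) (at x)) (at x)"
    by (simp add: frechet_derivative_works)
  then have "(*v) (hessian f x) = frechet_derivative (gradient f) (at x)"
    by (simp add: hessian_def matrix_vector_mul(2) has_derivative_linear)
  with D show ?thesis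
    by simp
qed

lemma gradient_eqI:
  fixes f :: "real^'n \<Rightarrow> real"
  assumes "(f has_derivative (\<lambda>v. G \<bullet> v)) (at x)"
  shows "gradient f x = G"
  unfolding gradient_def frechet_derivative_at[OF assms, symmetric]
  by (simp add: vec_eq_iff inner_axis)

text \<open>Agreement of \<open>gradient f\<close> with \<open>G\<close> on all of the open set
  \<open>U\<close>, not just at one point, lets the derivative of \<open>G\<close> pass to
  \<open>gradient f\<close>. This is how explicit formulas for sums, differences and quadratics are
  recognised as gradients and Hessians.\<close>

lemma
  fixes f :: "real^'n \<Rightarrow> real"
  assumes "open U"
    and D: "\<And>x. x \<in> U \<Longrightarrow> (f has_derivative (\<lambda>v. G x \<bullet> v)) (at x)"
    and D2: "\<And>x. x \<in> U \<Longrightarrow> (G has_derivative (*v) (H x)) (at x)"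
  shows hessian_eqI: "x \<in> U \<Longrightarrow> hessian f x = H x"
    and C2_onI: "continuous_on U H \<Longrightarrow> C2_on U f"
proof -
  have G: "gradient f x = G x" if "x \<in> U" for x
    using that D by (blast intro: gradient_eqI)
  have gD: "(gradient f has_derivative (*v) (H x)) (at x)" if "x \<in> U" for x
    by (rule has_derivative_transform_within_open[OF D2[OF that] \<open>open U\<close> that]) (simp add: G)
  have H: "hessian f x = H x" if "x \<in> U" for x
    unfolding hessian_def frechet_derivative_at[OF gD[OF that], symmetric] by simp
  then show "x \<in> U \<Longrightarrow> hessian f x = H x" .
  show "C2_on U f" if "continuous_on U H"
    unfolding C2_on_def
  proof (intro conjI)
    show "f differentiable_on U"
      using D \<open>open U\<close> by (auto simp: differentiable_on_eq_differentiable_at differentiable_def)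
    show "gradient f differentiable_on U"
      using gD \<open>open U\<close> by (auto simp: differentiable_on_eq_differentiable_at differentiable_def)
    show "continuous_on U (hessian f)"
      using that H by (simp cong: continuous_on_cong)
  qed
qed

lemma hessian_diff:
  fixes f g h :: "real^'n \<Rightarrow> real"
  assumes "open U" "C2_on U g" "C2_on U h" and f: "\<And>x. x \<in> U \<Longrightarrow> f x = g x - h x" and "x \<in> U"
  shows "hessian f x = hessian g x - hessian h x"
proof (rule hessian_eqI[OF \<open>open U\<close> _ _ \<open>x \<in> U\<close>])
  fix y assume y: "y \<in> U"
  have "((\<lambda>x. g x - h x) has_derivative (\<lambda>v. (gradient g y - gradient h y) \<bullet> v)) (at y)"
    using has_derivative_diff[OF C2_on_has_derivative[OF assms(2,1) y] C2_on_has_derivative[OF assms(3,1) y]]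
    by (simp add: inner_diff_left)
  then show "(f has_derivative (\<lambda>v. (gradient g y - gradient h y) \<bullet> v)) (at y)"
    by (rule has_derivative_transform_within_open[OF _ \<open>open U\<close> y]) (simp add: f)
  have "(*v) (hessian g y - hessian h y) = (\<lambda>v. hessian g y *v v - hessian h y *v v)"
    by (auto simp: matrix_vector_mult_diff_rdistrib)
  then show "((\<lambda>y. gradient g y - gradient h y) has_derivative (*v) (hessian g y - hessian h y)) (at y)"
    using has_derivative_diff[OF C2_on_gradient_has_derivative[OF assms(2,1) y]
        C2_on_gradient_has_derivative[OF assms(3,1) y]]
    by simp
qed

section \<open>Mixed second differences and symmetry of the Hessian\<close>

lemma has_real_derivative_along_line:
  fixes f :: "real^'n \<Rightarrow> real"
  assumes "C2_on U f" "open U" "z + t *\<^sub>R a \<in> U"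
  shows "((\<lambda>t. f (z + t *\<^sub>R a)) has_real_derivative gradient f (z + t *\<^sub>R a) \<bullet> a) (at t)"
proof -
  have "((\<lambda>t. z + t *\<^sub>R a) has_derivative (\<lambda>u. u *\<^sub>R a)) (at t)"
    by (auto intro!: derivative_eq_intros)
  from has_derivative_compose[OF this C2_on_has_derivative[OF assms]]
  show ?thesis
    by (simp add: has_field_derivative_def mult.commute[of _ "_ \<bullet> _"])
qed

lemma gradient_has_real_derivative_along_line:
  fixes f :: "real^'n \<Rightarrow> real"
  assumes "C2_on U f" "open U" "z + t *\<^sub>R b \<in> U"
  shows "((\<lambda>t. gradient f (z + t *\<^sub>R b) \<bullet> a) has_real_derivative
           a \<bullet> (hessian f (z + t *\<^sub>R b) *v b)) (at t)"
proof -
  have "((\<lambda>t. z + t *\<^sub>R b) has_derivative (\<lambda>u. u *\<^sub>R b)) (at t)"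
    by (auto intro!: derivative_eq_intros)
  from has_derivative_inner_left[OF has_derivative_compose[OF this C2_on_gradient_has_derivative[OF assms]], of a]
  show ?thesis
    by (simp add: has_field_derivative_def matrix_vector_mult_scaleR inner_commute mult.commute[of _ "_ \<bullet> _"])
qed

text \<open>The mean value theorem is applied twice, first along \<open>a\<close> to the increment
  of \<open>f\<close> in direction \<open>b\<close>, then along \<open>b\<close> to the derivative
  of \<open>f\<close> in direction \<open>a\<close>. Each application contributes one factor
  \<open>s\<close>.\<close>

lemma second_difference_eq:
  fixes f :: "real^'n \<Rightarrow> real"
  assumes C2: "C2_on U f" "open U" and "0 < s"
    and U: "\<And>p q. \<lbrakk>0 \<le> p; p \<le> s; 0 \<le> q; q \<le> s\<rbrakk> \<Longrightarrow> z + p *\<^sub>R a + q *\<^sub>R b \<in> U"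
  obtains p q where "0 < p" "p < s" "0 < q" "q < s"
    "f (z + s *\<^sub>R a + s *\<^sub>R b) - f (z + s *\<^sub>R a) - f (z + s *\<^sub>R b) + f z
       = s\<^sup>2 * (a \<bullet> (hessian f (z + p *\<^sub>R a + q *\<^sub>R b) *v b))"
proof -
  \<comment> \<open>The mixed second difference is \<open>F s - F 0\<close>.\<close>
  define F where "F p = f ((z + s *\<^sub>R b) + p *\<^sub>R a) - f (z + p *\<^sub>R a)" for p
  define F' where "F' p = gradient f ((z + s *\<^sub>R b) + p *\<^sub>R a) \<bullet> a - gradient f (z + p *\<^sub>R a) \<bullet> a" for p
  have "(F has_real_derivative F' p) (at p)" if "0 \<le> p" "p \<le> s" for p
    unfolding F_def F'_def
    using U[of p s] U[of p 0] that \<open>0 < s\<close>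
    by (intro DERIV_diff has_real_derivative_along_line[OF C2]) (auto simp: add_ac)
  then obtain p where p: "0 < p" "p < s" "F s - F 0 = (s - 0) * F' p"
    using MVT2[OF \<open>0 < s\<close>] by blast
  \<comment> \<open>With \<open>p\<close> frozen, \<open>F' p\<close> is the increment
    \<open>G s - G 0\<close>, which opens the way for the second mean value theorem.\<close>
  define G where "G q = gradient f ((z + p *\<^sub>R a) + q *\<^sub>R b) \<bullet> a" for q
  define G' where "G' q = a \<bullet> (hessian f ((z + p *\<^sub>R a) + q *\<^sub>R b) *v b)" for q
  have "(G has_real_derivative G' q) (at q)"
    if "0 \<le> q" "q \<le> s" for q
    unfolding G_def G'_def
    using U[of p q] that p by (intro gradient_has_real_derivative_along_line[OF C2]) auto
  then obtain q where q: "0 < q" "q < s"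
    "G s - G 0 = (s - 0) * G' q"
    using MVT2[OF \<open>0 < s\<close>] by blast
  have "F' p = G s - G 0"
    by (simp add: F'_def G_def add_ac)
  then have "F s - F 0 = s\<^sup>2 * (a \<bullet> (hessian f (z + p *\<^sub>R a + q *\<^sub>R b) *v b))"
    unfolding p(3) q(3) G'_def by (simp add: power2_eq_square)
  moreover have "F s - F 0 = f (z + s *\<^sub>R a + s *\<^sub>R b) - f (z + s *\<^sub>R a) - f (z + s *\<^sub>R b) + f z"
    by (simp add: F_def add_ac)
  ultimately show thesis
    using that p q by metis
qed

lemma continuous_on_hessian_form:
  assumes "continuous_on S H"
  shows "continuous_on S (\<lambda>z. (a::real^'n) \<bullet> (H z *v b))"
  unfolding inner_vec_def matrix_vector_mult_def
  using assms by (auto intro!: continuous_intros continuous_on_sum simp: continuous_on_component)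

text \<open>The intermediate point supplied by \<open>second_difference_eq\<close> lies within
  \<open>s * (norm a + norm b)\<close> of \<open>z\<close>, so continuity of the Hessian gives the
  limit.\<close>

lemma second_difference_tendsto:
  fixes f :: "real^'n \<Rightarrow> real"
  assumes C2: "C2_on U f" "open U" and "z \<in> U"
  shows "((\<lambda>s. (f (z + s *\<^sub>R a + s *\<^sub>R b) - f (z + s *\<^sub>R a) - f (z + s *\<^sub>R b) + f z) / s\<^sup>2)
           \<longlongrightarrow> a \<bullet> (hessian f z *v b)) (at_right 0)"
proof (rule tendstoI)
  fix e :: real assume "0 < e"
  let ?B = "\<lambda>y. a \<bullet> (hessian f y *v b)"
  have "continuous_on U ?B"
    using C2 by (intro continuous_on_hessian_form) (simp add: C2_on_def)
  then have "isCont ?B z"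
    using C2 \<open>z \<in> U\<close> continuous_on_eq_continuous_at by blast
  then have "\<forall>\<^sub>F y in nhds z. dist (?B y) (?B z) < e"
    using \<open>0 < e\<close> by (simp add: continuous_at tendsto_iff eventually_nhds_conv_at)
  moreover have "\<forall>\<^sub>F y in nhds z. y \<in> U"
    using C2 \<open>z \<in> U\<close> by (simp add: eventually_nhds_in_open)
  ultimately have "\<forall>\<^sub>F y in nhds z. y \<in> U \<and> dist (?B y) (?B z) < e"
    by (simp add: eventually_conj)
  then obtain d where "0 < d" and d: "\<And>y. dist y z < d \<Longrightarrow> y \<in> U \<and> dist (?B y) (?B z) < e"
    unfolding eventually_nhds_metric by blast
  \<comment> \<open>For \<open>s < r\<close> the whole parallelogram with corner \<open>z\<close>
    and sides \<open>s *\<^sub>R a\<close>, \<open>s *\<^sub>R b\<close> stays in the ball of radius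
    \<open>d\<close>. The summand 1 keeps the denominator positive when
    \<open>a = b = 0\<close>.\<close>
  define r where "r = d / (norm a + norm b + 1)"
  have "0 < r"
    using \<open>0 < d\<close> by (auto simp: r_def intro!: divide_pos_pos add_nonneg_pos)
  have near: "dist (z + p *\<^sub>R a + q *\<^sub>R b) z < d" if "s < r" "0 \<le> p" "p \<le> s" "0 \<le> q" "q \<le> s" for p q s
  proof -
    have "dist (z + p *\<^sub>R a + q *\<^sub>R b) z \<le> p * norm a + q * norm b"
      using that norm_triangle_ineq[of "p *\<^sub>R a" "q *\<^sub>R b"] by (simp add: dist_norm add.assoc)
    also have "\<dots> \<le> s * norm a + s * norm b"
      using that by (intro add_mono mult_right_mono) auto
    also have "\<dots> \<le> s * (norm a + norm b + 1)"
      using that by (simp add: algebra_simps)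
    also have "\<dots> < r * (norm a + norm b + 1)"
      using that by (intro mult_strict_right_mono) (auto intro: add_nonneg_pos)
    also have "\<dots> = d"
      unfolding r_def by (smt (verit) nonzero_eq_divide_eq norm_ge_zero)
    finally show ?thesis .
  qed
  have "dist ((f (z + s *\<^sub>R a + s *\<^sub>R b) - f (z + s *\<^sub>R a) - f (z + s *\<^sub>R b) + f z) / s\<^sup>2) (?B z) < e"
    if s: "0 < s" "s < r" for s
  proof -
    obtain p q where pq: "0 < p" "p < s" "0 < q" "q < s"
      "f (z + s *\<^sub>R a + s *\<^sub>R b) - f (z + s *\<^sub>R a) - f (z + s *\<^sub>R b) + f z
         = s\<^sup>2 * ?B (z + p *\<^sub>R a + q *\<^sub>R b)"
    proof (rule second_difference_eq[OF C2 \<open>0 < s\<close>, of z a b])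
      show "z + p *\<^sub>R a + q *\<^sub>R b \<in> U" if "0 \<le> p" "p \<le> s" "0 \<le> q" "q \<le> s" for p q
        using d[OF near[OF \<open>s < r\<close> that]] by simp
    qed
    then show ?thesis
      using d[OF near[OF \<open>s < r\<close>, of p q]] s by simp
  qed
  then show "\<forall>\<^sub>F s in at_right 0.
      dist ((f (z + s *\<^sub>R a + s *\<^sub>R b) - f (z + s *\<^sub>R a) - f (z + s *\<^sub>R b) + f z) / s\<^sup>2) (?B z) < e"
    using \<open>0 < r\<close> unfolding eventually_at_right_field by blast
qed

lemma hessian_symmetric:
  fixes f :: "real^'n \<Rightarrow> real"
  assumes "C2_on U f" "open U" "z \<in> U"
  shows "a \<bullet> (hessian f z *v b) = b \<bullet> (hessian f z *v a)"
proof (rule tendsto_unique)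
  show "((\<lambda>s. (f (z + s *\<^sub>R b + s *\<^sub>R a) - f (z + s *\<^sub>R b) - f (z + s *\<^sub>R a) + f z) / s\<^sup>2)
           \<longlongrightarrow> a \<bullet> (hessian f z *v b)) (at_right 0)"
    using second_difference_tendsto[OF assms, of a b] by (simp add: algebra_simps)
qed (use second_difference_tendsto[OF assms] in auto)

section \<open>Convexity and positive semidefinite Hessians\<close>

lemma convex_on_imp_hessian_nonneg_interior:
  fixes f :: "real^'n \<Rightarrow> real"
  assumes "C2_on U f" "open U" "S \<subseteq> U" "convex_on S f" "z \<in> interior S"
  shows "0 \<le> w \<bullet> (hessian f z *v w)"
proof -
  \<comment> \<open>The first term collapses to \<open>f z\<close>, so the numerator is
    \<open>2 * f z\<close> minus the values at two points symmetric about \<open>z\<close>. Both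
    points lie in \<open>S\<close> for small \<open>s\<close> because \<open>z\<close> is
    interior.\<close>
  let ?Q = "\<lambda>s. (f (z + s *\<^sub>R w + s *\<^sub>R (-w)) - f (z + s *\<^sub>R w) - f (z + s *\<^sub>R (-w)) + f z) / s\<^sup>2"
  have "z \<in> U"
    using assms interior_subset by blast
  have in_S: "\<forall>\<^sub>F s in at_right 0. z + s *\<^sub>R v \<in> S" for v
  proof -
    have "((\<lambda>s. z + s *\<^sub>R v) \<longlongrightarrow> z + 0 *\<^sub>R v) (at_right 0)"
      by (intro tendsto_intros)
    then have "\<forall>\<^sub>F s in at_right 0. z + s *\<^sub>R v \<in> interior S"
      using assms(5) by (intro topological_tendstoD) auto
    then show ?thesis
      by (rule eventually_mono) (use interior_subset in blast)
  qed
  have "\<forall>\<^sub>F s in at_right 0. ?Q s \<le> 0"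
    using in_S[of w] in_S[of "-w"]
  proof eventually_elim
    case (elim s)
    have "f ((1/2) *\<^sub>R (z + s *\<^sub>R w) + (1/2) *\<^sub>R (z + s *\<^sub>R (-w)))
        \<le> (1/2) * f (z + s *\<^sub>R w) + (1/2) * f (z + s *\<^sub>R (-w))"
      using convex_onD[OF assms(4), of "1/2" "z + s *\<^sub>R w" "z + s *\<^sub>R (-w)"] elim by simp
    moreover have "(1/2) *\<^sub>R (z + s *\<^sub>R w) + (1/2) *\<^sub>R (z + s *\<^sub>R (-w)) = z"
      by (simp add: algebra_simps flip: scaleR_add_left)
    ultimately show ?case
      by (auto simp: divide_le_0_iff)
  qed
  then have "w \<bullet> (hessian f z *v (-w)) \<le> 0"
    using second_difference_tendsto[OF assms(1,2) \<open>z \<in> U\<close>, of w "-w"]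
    by (intro tendsto_upperbound) auto
  then show ?thesis
    by (simp add: linear_neg[OF matrix_vector_mul_linear])
qed

text \<open>A closed convex set with nonempty interior is the closure of its interior, so the
  inequality extends to boundary points by continuity of the Hessian.\<close>

lemma convex_on_imp_hessian_nonneg:
  fixes f :: "real^'n \<Rightarrow> real"
  assumes "C2_on U f" "open U" "S \<subseteq> U" "convex_on S f"
    and "closed S" "interior S \<noteq> {}" "z \<in> S"
  shows "0 \<le> w \<bullet> (hessian f z *v w)"
proof -
  have "convex S"
    using assms(4) by (rule convex_on_imp_convex)
  then have cl: "closure (interior S) = S"
    using assms by (simp add: convex_closure_interior)
  have "continuous_on (closure (interior S)) (\<lambda>z. w \<bullet> (hessian f z *v w))"
    unfolding cl using assms(1,3)
    by (intro continuous_on_hessian_form) (auto simp: C2_on_def intro: continuous_on_subset)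
  then show ?thesis
    by (rule continuous_ge_on_closure)
       (use cl assms in \<open>auto intro: convex_on_imp_hessian_nonneg_interior\<close>)
qed

text \<open>Reduction to one variable: along the segment from \<open>x\<close> to \<open>y\<close>
  the second derivative of \<open>f\<close> is the Hessian form in direction
  \<open>y - x\<close>.\<close>

lemma hessian_nonneg_imp_convex_on:
  fixes f :: "real^'n \<Rightarrow> real"
  assumes C2: "C2_on U f" "open U" and "S \<subseteq> U" "convex S"
    and nonneg: "\<And>z w. z \<in> S \<Longrightarrow> 0 \<le> w \<bullet> (hessian f z *v w)"
  shows "convex_on S f"
proof (rule convex_onI)
  fix t :: real and x y
  assume t: "0 < t" "t < 1" and xy: "x \<in> S" "y \<in> S"
  define c where "c u = x + u *\<^sub>R (y - x)" for u
  have c: "c u \<in> S" if "u \<in> {0..1}" for u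
    using convexD_alt[OF \<open>convex S\<close> xy, of u] that by (simp add: c_def algebra_simps)
  have "convex_on {0..1} (\<lambda>u. f (c u))"
  proof (rule f''_ge0_imp_convex)
    fix u :: real assume "u \<in> {0..1}"
    from c[OF this] have "x + u *\<^sub>R (y - x) \<in> S"
      by (simp add: c_def)
    with \<open>S \<subseteq> U\<close> nonneg
    show "((\<lambda>u. f (c u)) has_real_derivative gradient f (x + u *\<^sub>R (y - x)) \<bullet> (y - x)) (at u)"
      "((\<lambda>u. gradient f (x + u *\<^sub>R (y - x)) \<bullet> (y - x)) has_real_derivative
         (y - x) \<bullet> (hessian f (x + u *\<^sub>R (y - x)) *v (y - x))) (at u)"
      "0 \<le> (y - x) \<bullet> (hessian f (x + u *\<^sub>R (y - x)) *v (y - x))"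
      unfolding c_def
      by (blast intro: has_real_derivative_along_line[OF C2]
          gradient_has_real_derivative_along_line[OF C2])+
  qed simp
  from convex_onD[OF this, of t 0 1] t
  show "f ((1 - t) *\<^sub>R x + t *\<^sub>R y) \<le> (1 - t) * f x + t * f y"
    by (simp add: c_def algebra_simps)
qed fact

section \<open>Existence of decompositions into convex functions\<close>

text \<open>The form is bounded on the compact set \<open>K \<times> sphere 0 1\<close>, and its
  homogeneity of degree 2 in \<open>w\<close> carries the bound over to all vectors.\<close>

lemma continuous_form_bounded_below:
  fixes H :: "real^'n \<Rightarrow> real^'n^'n"
  assumes "compact K" "continuous_on K H"
  obtains c where "0 \<le> c" "\<And>z w. z \<in> K \<Longrightarrow> - c * (w \<bullet> w) \<le> w \<bullet> (H z *v w)"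
proof -
  have "compact ((\<lambda>(z, w). w \<bullet> (H z *v w)) ` (K \<times> sphere 0 1))"
  proof (rule compact_continuous_image)
    have 1: "continuous_on (K \<times> sphere 0 1) (\<lambda>p. H (fst p) $ i $ j)" for i j
      by (intro continuous_on_component continuous_on_compose2[OF assms(2)] continuous_on_fst
          continuous_on_id) auto
    show "continuous_on (K \<times> sphere 0 1) (\<lambda>(z, w::real^'n). w \<bullet> (H z *v w))"
      unfolding inner_vec_def matrix_vector_mult_def split_def
      by (auto intro!: continuous_intros continuous_on_component 1)
  qed (simp add: assms compact_Times)
  then obtain B where B: "\<And>z w. z \<in> K \<Longrightarrow> norm w = 1 \<Longrightarrow> \<bar>w \<bullet> (H z *v w)\<bar> \<le> B"
    by (force simp: bounded_iff dest!: compact_imp_bounded)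
  show thesis
  proof
    \<comment> \<open>The absolute value matters for empty \<open>K\<close>, where nothing forces
      \<open>B\<close> to be nonnegative.\<close>
    show "0 \<le> \<bar>B\<bar>"
      by simp
    fix z w assume "z \<in> K"
    show "- \<bar>B\<bar> * (w \<bullet> w) \<le> w \<bullet> (H z *v w)"
    proof (cases "w = 0")
      case False
      define u where "u = w /\<^sub>R norm w"
      have "w = norm w *\<^sub>R u" "norm u = 1"
        using False by (auto simp: u_def)
      have "w \<bullet> (H z *v w) = (norm w)\<^sup>2 * (u \<bullet> (H z *v u))"
        by (subst (1 2) \<open>w = norm w *\<^sub>R u\<close>) (simp add: matrix_vector_mult_scaleR power2_eq_square)
      moreover have "(norm w)\<^sup>2 * (- \<bar>B\<bar>) \<le> (norm w)\<^sup>2 * (u \<bullet> (H z *v u))"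
        using B[OF \<open>z \<in> K\<close> \<open>norm u = 1\<close>] by (intro mult_left_mono) auto
      ultimately show ?thesis
        by (simp add: power2_norm_eq_inner mult.commute)
    qed simp
  qed
qed

lemma has_derivative_half_square:
  "((\<lambda>x. c / 2 * (x \<bullet> x)) has_derivative (\<lambda>v. (c *\<^sub>R x) \<bullet> v)) (at (x::real^'n))"
  by (auto intro!: derivative_eq_intros simp: inner_commute)

lemma has_derivative_scaleR_mat:
  "((\<lambda>x. c *\<^sub>R x) has_derivative (*v) (c *\<^sub>R mat 1)) (at (x::real^'n))"
  by (auto intro!: derivative_eq_intros simp: scaleR_matrix_vector_assoc[symmetric])

text \<open>A sufficiently large multiple of the squared norm convexifies \<open>f\<close> on the hull.\<close>

lemma D2_nonempty:
  fixes f :: "real^'n \<Rightarrow> real"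
  assumes "compact X" "open U" "convex hull X \<subseteq> U" "C2_on U f"
  shows "D2 f X \<noteq> {}"
proof -
  obtain c where "0 \<le> c"
    and c: "\<And>z w. z \<in> convex hull X \<Longrightarrow> - c * (w \<bullet> w) \<le> w \<bullet> (hessian f z *v w)"
  proof (rule continuous_form_bounded_below)
    show "compact (convex hull X)"
      using assms by (simp add: compact_convex_hull)
    show "continuous_on (convex hull X) (hessian f)"
      using assms by (auto simp: C2_on_def intro: continuous_on_subset)
  qed blast
  \<comment> \<open>The factor 1/2 makes the Hessian of \<open>h\<close> equal to \<open>c\<close>
    times the identity, which exactly offsets the lower bound \<open>- c\<close> for the form of
    \<open>f\<close>.\<close>
  define h :: "real^'n \<Rightarrow> real" where "h x = c / 2 * (x \<bullet> x)" for x
  define g where "g x = f x + h x" for x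
  note h_derivs = has_derivative_half_square[of c] has_derivative_scaleR_mat[of c]
  have h: "C2_on U h" "\<And>x. x \<in> U \<Longrightarrow> hessian h x = c *\<^sub>R mat 1"
    unfolding h_def[abs_def]
    by (rule C2_onI[OF \<open>open U\<close> h_derivs] hessian_eqI[OF \<open>open U\<close> h_derivs]; simp)+
  have g_derivs: "(g has_derivative (\<lambda>v. (gradient f x + c *\<^sub>R x) \<bullet> v)) (at x)"
    "((\<lambda>x. gradient f x + c *\<^sub>R x) has_derivative (*v) (hessian f x + c *\<^sub>R mat 1)) (at x)"
    if "x \<in> U" for x
    using has_derivative_add[OF C2_on_has_derivative[OF assms(4,2) that] h_derivs(1)]
      has_derivative_add[OF C2_on_gradient_has_derivative[OF assms(4,2) that] h_derivs(2)]
    by (simp_all add: g_def[abs_def] h_def inner_add_left matrix_vector_mult_add_rdistrib[abs_def])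
  have g: "C2_on U g" "\<And>x. x \<in> U \<Longrightarrow> hessian g x = hessian f x + c *\<^sub>R mat 1"
    using assms(4)
    by (auto intro!: C2_onI[OF \<open>open U\<close> g_derivs] hessian_eqI[OF \<open>open U\<close> g_derivs] continuous_intros
        simp: C2_on_def[of U f])
  have form_add: "w \<bullet> ((A + c *\<^sub>R mat 1) *v w) = w \<bullet> (A *v w) + c * (w \<bullet> w)" for A and w :: "real^'n"
    by (simp add: matrix_vector_mult_add_rdistrib inner_add_right scaleR_matrix_vector_assoc[symmetric])
  have "convex_on (convex hull X) g"
  proof (rule hessian_nonneg_imp_convex_on[OF g(1) assms(2,3)])
    fix z w :: "real^'n" assume "z \<in> convex hull X"
    then show "0 \<le> w \<bullet> (hessian g z *v w)"
      using c[of z w] assms(3) by (auto simp: g(2) form_add)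
  qed simp
  moreover have "convex_on (convex hull X) h"
  proof (rule hessian_nonneg_imp_convex_on[OF h(1) assms(2,3)])
    fix z w :: "real^'n" assume "z \<in> convex hull X"
    then show "0 \<le> w \<bullet> (hessian h z *v w)"
      using \<open>0 \<le> c\<close> assms(3) form_add[of w 0] by (auto simp: h(2))
  qed simp
  ultimately have "(g, h) \<in> D2 f X"
    unfolding D2_def using assms h g by (auto simp: g_def)
  then show ?thesis
    by blast
qed

section \<open>Attainment of \<open>d_star\<close> and \<open>m_minus\<close>\<close>

lemma d_star_attained:
  assumes "D2 f X \<noteq> {}"
  obtains g h where "(g, h) \<in> D2 f X" "d_star f X = d_dim X g"
proof -
  have "d_star f X \<in> (\<lambda>(g, h). d_dim X g) ` D2 f X"
    unfolding d_star_def by (rule Inf_nat_def1) (use assms in simp)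
  then show thesis
    using that by auto
qed

text \<open>Every dimension is at most \<open>CARD('n)\<close>; finiteness is what gives
  \<open>Max\<close> in \<open>m_minus\<close> its meaning.\<close>

lemma finite_m_minus_dims:
  "finite {dim W | W :: (real^'n) set. subspace W \<and>
     (\<forall>w\<in>W. \<forall>z\<in>convex hull X. w \<bullet> (hessian f z *v w) \<le> 0)}"
  by (rule finite_subset[of _ "{..CARD('n)}"]) (auto intro: order_trans[OF dim_subset_UNIV])

lemma dim_le_m_minus:
  fixes W :: "(real^'n) set"
  assumes "subspace W" "\<And>w z. w \<in> W \<Longrightarrow> z \<in> convex hull X \<Longrightarrow> w \<bullet> (hessian f z *v w) \<le> 0"
  shows "dim W \<le> m_minus f X"
  unfolding m_minus_def by (rule Max_ge[OF finite_m_minus_dims]) (use assms in blast)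

lemma m_minus_attained:
  fixes f :: "real^'n \<Rightarrow> real"
  obtains W where "subspace W" "\<And>w z. w \<in> W \<Longrightarrow> z \<in> convex hull X \<Longrightarrow> w \<bullet> (hessian f z *v w) \<le> 0"
    "m_minus f X = dim W"
proof -
  let ?M = "{dim W | W :: (real^'n) set. subspace W \<and>
     (\<forall>w\<in>W. \<forall>z\<in>convex hull X. w \<bullet> (hessian f z *v w) \<le> 0)}"
  \<comment> \<open>The zero subspace is always admissible, so the maximum is taken over a nonempty
    set.\<close>
  have "dim {0::real^'n} \<in> ?M"
    by (intro CollectI exI[of _ "{0}"]) auto
  then have "m_minus f X \<in> ?M"
    unfolding m_minus_def by (intro Max_in finite_m_minus_dims) blast
  then show thesis
    using that by blast
qed

section \<open>The first inequality\<close>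

text \<open>The orthogonal complement of \<open>V_space X g\<close> is a competitor in the
  definition of \<open>m_minus\<close>: on it the form of \<open>g\<close> vanishes and that of
  \<open>- h\<close> is nonpositive. The additive form avoids truncated subtraction of
  naturals.\<close>

lemma card_minus_m_minus_le_d_dim:
  fixes f :: "real^'n \<Rightarrow> real"
  assumes "compact X" "affine hull X = UNIV" "(g, h) \<in> D2 f X"
  shows "CARD('n) \<le> d_dim X g + m_minus f X"
proof -
  let ?V = "V_space X g"
  obtain U where U: "open U" "convex hull X \<subseteq> U" "C2_on U g" "C2_on U h"
      "\<And>x. x \<in> U \<Longrightarrow> f x = g x - h x" and "convex_on (convex hull X) h"
    using assms(3) by (auto simp: D2_def)
  \<comment> \<open>Full dimensionality of \<open>X\<close> enters here: the relative interior of
    the hull, nonempty by convexity, is its interior. The semidefiniteness of the Hessian of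
    \<open>h\<close> rests on this.\<close>
  have "interior (convex hull X) \<noteq> {}"
  proof -
    have "affine hull (convex hull X) = UNIV"
      using assms by simp
    moreover have "X \<noteq> {}"
      using assms(2) by auto
    ultimately show ?thesis
      by (metis convex_convex_hull convex_hull_eq_empty rel_interior_eq_empty rel_interior_interior)
  qed
  define W where "W = {w. \<forall>v\<in>?V. orthogonal v w}"
  have "dim W \<le> m_minus f X"
  proof (rule dim_le_m_minus)
    show "subspace W"
      unfolding W_def by (rule subspace_orthogonal_to_vectors)
    fix w z assume "w \<in> W" and z: "z \<in> convex hull X"
    have "hessian g z *v w \<in> ?V"
      unfolding V_space_def using z by (intro span_base) blast
    with \<open>w \<in> W\<close> have "w \<bullet> (hessian g z *v w) = 0"
      by (auto simp: W_def orthogonal_def inner_commute)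
    moreover have "0 \<le> w \<bullet> (hessian h z *v w)"
      using U z assms \<open>interior (convex hull X) \<noteq> {}\<close> \<open>convex_on (convex hull X) h\<close>
      by (intro convex_on_imp_hessian_nonneg[where U = U and S = "convex hull X"])
         (auto simp: compact_convex_hull compact_imp_closed)
    moreover have "hessian f z = hessian g z - hessian h z"
      by (rule hessian_diff[OF U(1,3,4,5)]) (use U z in auto)
    ultimately show "w \<bullet> (hessian f z *v w) \<le> 0"
      by (simp add: matrix_vector_mult_diff_rdistrib inner_diff_right)
  qed
  moreover have "dim W + dim ?V = CARD('n)"
    using dim_subspace_orthogonal_to_vectors[of ?V UNIV] by (simp add: W_def V_space_def)
  ultimately show ?thesis
    by (simp add: d_dim_def)
qed

section \<open>Positive eigenvalues and the second inequality\<close>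

lemma subspace_eigenspace: "subspace (eigenspace (Q::real^'n^'n) l)"
  by (auto simp: subspace_def eigenspace_def matrix_vector_right_distrib matrix_vector_mult_scaleR
      scaleR_add_right)

text \<open>By symmetry, eigenspaces to distinct eigenvalues are orthogonal. Adding one eigenspace
  at a time, the dimensions therefore add up and the form acquires no cross terms.\<close>

lemma sum_eigenspaces_positive:
  fixes Q :: "real^'n^'n"
  assumes sym: "\<And>a b. a \<bullet> (Q *v b) = b \<bullet> (Q *v a)" and "finite L" "\<And>l. l \<in> L \<Longrightarrow> 0 < l"
  shows "dim (span (\<Union>l\<in>L. eigenspace Q l)) = (\<Sum>l\<in>L. dim (eigenspace Q l)) \<and>
    (\<forall>v\<in>span (\<Union>l\<in>L. eigenspace Q l). v \<noteq> 0 \<longrightarrow> 0 < v \<bullet> (Q *v v))"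
  using assms(2,3)
proof (induction L rule: finite_induct)
  case (insert l L)
  let ?E = "eigenspace Q l" and ?S = "span (\<Union>l\<in>L. eigenspace Q l)"
  have IH: "dim ?S = (\<Sum>l\<in>L. dim (eigenspace Q l))" "\<And>v. v \<in> ?S \<Longrightarrow> v \<noteq> 0 \<Longrightarrow> 0 < v \<bullet> (Q *v v)"
    using insert by auto
  have orth: "x \<bullet> y = 0" if "x \<in> ?E" "y \<in> ?S" for x y
  proof -
    have "x \<bullet> u = 0" if "m \<in> L" "u \<in> eigenspace Q m" for m u
    proof -
      \<comment> \<open>Both sides equal \<open>x \<bullet> (Q *v u)\<close>, evaluated once
        directly and once after moving \<open>Q\<close> to \<open>x\<close> by symmetry.\<close>
      have "m * (x \<bullet> u) = l * (x \<bullet> u)"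
        using sym[of x u] \<open>x \<in> ?E\<close> that by (auto simp: eigenspace_def inner_commute)
      moreover have "m \<noteq> l"
        using insert that by blast
      ultimately show ?thesis
        by simp
    qed
    then have "orthogonal x u" if "u \<in> (\<Union>l\<in>L. eigenspace Q l)" for u
      using that by (auto simp: orthogonal_def)
    from orthogonal_to_span[OF \<open>y \<in> ?S\<close> this] show ?thesis
      by (simp add: orthogonal_def)
  qed
  have span_insert: "span (\<Union>l\<in>insert l L. eigenspace Q l) = {x + y |x y. x \<in> ?E \<and> y \<in> ?S}"
    by (simp add: span_Un span_eq_iff[THEN iffD2, OF subspace_eigenspace])
  \<comment> \<open>A common vector is orthogonal to itself.\<close>
  have "?E \<inter> ?S = {0}"
  proof
    show "{0} \<subseteq> ?E \<inter> ?S"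
      using subspace_0[OF subspace_eigenspace] by (simp add: span_zero)
  qed (use orth in force)
  then have "dim {x + y |x y. x \<in> ?E \<and> y \<in> ?S} = dim ?E + dim ?S"
    using dim_sums_Int[OF subspace_eigenspace subspace_span, of Q l "\<Union>l\<in>L. eigenspace Q l"] by simp
  moreover have "0 < v \<bullet> (Q *v v)" if "v = x + y" "x \<in> ?E" "y \<in> ?S" "v \<noteq> 0" for v x y
  proof -
    have Qx: "Q *v x = l *\<^sub>R x"
      using that by (simp add: eigenspace_def)
    \<comment> \<open>The cross terms vanish: \<open>x \<bullet> (Q *v y)\<close> and
      \<open>y \<bullet> (Q *v x)\<close> agree, and the latter is
      \<open>l * (y \<bullet> x) = 0\<close>.\<close>
    have "v \<bullet> (Q *v v) = l * (x \<bullet> x) + y \<bullet> (Q *v y)"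
      using orth[OF that(2,3)] sym[of x y]
      by (simp add: that(1) matrix_vector_right_distrib inner_add_left inner_add_right Qx inner_commute)
    moreover have "0 < l"
      using insert by simp
    moreover have "0 \<le> y \<bullet> (Q *v y)" "x \<noteq> 0 \<or> 0 < y \<bullet> (Q *v y)"
      using IH(2)[OF that(3)] that by (cases "y = 0"; force)+
    ultimately show ?thesis
      by (cases "x = 0") (auto intro: add_pos_nonneg)
  qed
  ultimately show ?case
    unfolding span_insert using insert.hyps IH(1) by auto
qed simp

text \<open>A subspace on which the form is positive definite meets one on which it is nonpositive
  only in 0, so their dimensions add up to at most that of the whole space.\<close>

lemma n_plus_plus_dim_le:
  fixes Q :: "real^'n^'n"
  assumes sym: "\<And>a b. a \<bullet> (Q *v b) = b \<bullet> (Q *v a)"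
    and W: "subspace W" "\<And>w. w \<in> W \<Longrightarrow> w \<bullet> (Q *v w) \<le> 0"
  shows "n_plus Q + dim W \<le> CARD('n)"
proof (cases "finite {l. 0 < l \<and> eigenspace Q l \<noteq> {0}}")
  case True
  let ?S = "span (\<Union>l\<in>{l. 0 < l \<and> eigenspace Q l \<noteq> {0}}. eigenspace Q l)"
  have S: "dim ?S = n_plus Q" "\<And>v. v \<in> ?S \<Longrightarrow> v \<noteq> 0 \<Longrightarrow> 0 < v \<bullet> (Q *v v)"
    using sum_eigenspaces_positive[OF sym True] by (auto simp: n_plus_def)
  have "?S \<inter> W = {0}"
    using S(2) W subspace_0 by (fastforce simp: span_zero)
  then have "dim {x + y |x y. x \<in> ?S \<and> y \<in> W} = n_plus Q + dim W"
    using dim_sums_Int[OF subspace_span W(1), of "\<Union>l\<in>{l. 0 < l \<and> eigenspace Q l \<noteq> {0}}. eigenspace Q l"]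
      S(1) by simp
  then show ?thesis
    using dim_subset_UNIV[of "{x + y |x y. x \<in> ?S \<and> y \<in> W}"] by simp
next
  \<comment> \<open>A sum over an infinite index set has the default value 0, so
    \<open>n_plus Q\<close> is 0 here and only the bound on \<open>dim W\<close> remains.\<close>
  case False
  then show ?thesis
    using dim_subset_UNIV[of W] by (simp add: n_plus_def)
qed

theorem proposition5p1:
  fixes X U :: "(real^'n) set" and f :: "real^'n \<Rightarrow> real"
  assumes "compact X" and "affine hull X = UNIV"
    and "open U" and "convex hull X \<subseteq> U" and "C2_on U f"
  shows "int (d_star f X) \<ge> int CARD('n) - int (m_minus f X) \<and>
    int CARD('n) - int (m_minus f X) \<ge> int (SUP z \<in> convex hull X. n_plus (hessian f z))"
proof -
  obtain g h where "(g, h) \<in> D2 f X" "d_star f X = d_dim X g"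
    using d_star_attained D2_nonempty assms by metis
  then have "CARD('n) \<le> d_star f X + m_minus f X"
    using card_minus_m_minus_le_d_dim assms by metis
  moreover obtain W where W: "subspace W"
    "\<And>w z. w \<in> W \<Longrightarrow> z \<in> convex hull X \<Longrightarrow> w \<bullet> (hessian f z *v w) \<le> 0" "m_minus f X = dim W"
    using m_minus_attained by metis
  have n_plus_le: "n_plus (hessian f z) + m_minus f X \<le> CARD('n)" if "z \<in> convex hull X" for z
    unfolding W(3)
    using that assms W by (intro n_plus_plus_dim_le) (auto intro: hessian_symmetric)
  \<comment> \<open>The affine hull of the empty set is empty. Nonemptiness is what allows a
    pointwise bound to pass to the supremum of naturals.\<close>
  have "X \<noteq> {}"
    using assms(2) by auto
  then have "(SUP z \<in> convex hull X. n_plus (hessian f z)) \<le> CARD('n) - m_minus f X"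
    by (intro cSUP_least) (use n_plus_le in fastforce)+
  \<comment> \<open>With this bound the truncated difference of naturals above agrees with the
    integer difference in the goal.\<close>
  moreover have "m_minus f X \<le> CARD('n)"
    using W(3) dim_subset_UNIV[of W] by simp
  ultimately show ?thesis
    by linarith
qed

end
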